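(* Let $\mathcal{X}=\ell^p$ for some $1\le p<\infty$, or $\mathcal{X}=c_0$, and let $W=(w_n)_{n\ge1}$ be a bounded sequence of positive real numbers. Let $B_W$ be the weighted backward shift on $\mathcal{X}$ with weight sequence $W$, that is, the bounded linear operator determined by $B_W(e_0)=0$ and $B_W(e_n)=w_ne_{n-1}$ for $n\ge1$, where $(e_n)_{n\ge0}$ is the canonical basis of $\mathcal{X}$. Then $$\epsilon(B_W)=\inf_{n\ge1}w_n.$$
   Context: For a bounded linear operator $T$ on a Banach space $\mathcal{X}$ with open unit ball $B=\{x\in\mathcal{X}:\|x\|<1\}$, the constant $\epsilon(T)$ is defined by $$\epsilon(T)=\inf\{\|y\|: y\in\mathcal{X}\setminus T(B)\}.$$ Here $\ell^p$ ($1\le p<\infty$) is the space of all complex sequences $(a_n)_{n\ge0}$ with $\sum_{n\ge0}|a_n|^p<\infty$, with norm $\|(a_n)_n\|=(\sum_{n\ge0}|a_n|^p)^{1/p}$, and $c_0$ is the space of all complex sequences $(a_n)_{n\ge0}$ with $a_n\to0$, with norm $\|(a_n)_n\|=\sup_{n\ge0}|a_n|$. Explicitly, $B_W(a_0,a_1,a_2,\dots)=(w_1a_1,w_2a_2,\dots)$. *)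

theory Defs
  imports "HOL-Analysis.Analysis"
begin

text \<open>The exponent \<open>p\<close> is a variable of the statement, so the sequence spaces cannot be
  types of class \<open>banach\<close>; a space is given by a carrier set together with a norm on it.\<close>

text \<open>The constant of an operator \<open>T\<close> on the space with carrier \<open>X\<close> and norm \<open>N\<close>.
  For bounded \<open>T\<close> on a nonzero space the set below is nonempty, since \<open>T\<close> maps the unit ball
  to a bounded set, so the real infimum is the genuine one.\<close>

definition epsilon :: "'a set \<Rightarrow> ('a \<Rightarrow> real) \<Rightarrow> ('a \<Rightarrow> 'a) \<Rightarrow> real" where
  "epsilon X N T = Inf (N ` (X - T ` {x \<in> X. N x < 1}))"

definition ell :: "real \<Rightarrow> (nat \<Rightarrow> complex) set" where
  "ell p = {a. summable (\<lambda>n. norm (a n) powr p)}"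

definition ell_norm :: "real \<Rightarrow> (nat \<Rightarrow> complex) \<Rightarrow> real" where
  "ell_norm p a = (\<Sum>n. norm (a n) powr p) powr (1 / p)"

definition c_null :: "(nat \<Rightarrow> complex) set" where
  "c_null = {a. a \<longlonglongrightarrow> 0}"

definition sup_norm :: "(nat \<Rightarrow> complex) \<Rightarrow> real" where
  "sup_norm a = (SUP n. norm (a n))"

text \<open>Weights are indexed from \<open>1\<close>; the value \<open>w 0\<close> is never used.\<close>

definition weighted_shift :: "(nat \<Rightarrow> real) \<Rightarrow> (nat \<Rightarrow> complex) \<Rightarrow> nat \<Rightarrow> complex" where
  "weighted_shift w a = (\<lambda>n. of_real (w (Suc n)) * a (Suc n))"

definition unit_seq :: "nat \<Rightarrow> nat \<Rightarrow> complex" where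
  "unit_seq n = (\<lambda>k. if k = n then 1 else 0)"

text \<open>The following facts confirm that \<open>weighted_shift w\<close> is a bounded linear operator on each of
  the spaces, with the prescribed values on the canonical basis.\<close>

lemma weighted_shift_unit_0: "weighted_shift w (unit_seq 0) = (\<lambda>_. 0)"
  by (simp add: weighted_shift_def unit_seq_def)

lemma weighted_shift_unit:
  "n \<ge> 1 \<Longrightarrow> weighted_shift w (unit_seq n) = (\<lambda>k. of_real (w n) * unit_seq (n - 1) k)"
  by (auto simp: weighted_shift_def unit_seq_def fun_eq_iff)

lemma weighted_shift_linear:
  "weighted_shift w (\<lambda>n. c * a n + d * b n) =
     (\<lambda>n. c * weighted_shift w a n + d * weighted_shift w b n)"
  by (simp add: weighted_shift_def algebra_simps)

lemma weighted_shift_ell: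
  fixes p :: real
  assumes p: "1 \<le> p" and w: "\<And>n. n \<ge> 1 \<Longrightarrow> 0 < w n \<and> w n \<le> M" and a: "a \<in> ell p"
  shows "weighted_shift w a \<in> ell p"
    and "ell_norm p (weighted_shift w a) \<le> M * ell_norm p a"
proof -
  have M: "0 < M" using w[of 1] by auto
  have sa: "summable (\<lambda>n. norm (a n) powr p)" using a by (simp add: ell_def)
  have sS: "summable (\<lambda>n. norm (a (Suc n)) powr p)"
    using sa by (subst summable_Suc_iff)
  have le: "norm (weighted_shift w a n) powr p \<le> M powr p * norm (a (Suc n)) powr p" for n
  proof -
    have "norm (weighted_shift w a n) \<le> M * norm (a (Suc n))"
      using w[of "Suc n"] by (simp add: weighted_shift_def norm_mult mult_right_mono)
    then have "norm (weighted_shift w a n) powr p \<le> (M * norm (a (Suc n))) powr p"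
      using p by (intro powr_mono2) auto
    then show ?thesis using M by (simp add: powr_mult)
  qed
  have sM: "summable (\<lambda>n. M powr p * norm (a (Suc n)) powr p)"
    using sS by (rule summable_mult)
  have sb: "summable (\<lambda>n. norm (weighted_shift w a n) powr p)"
    by (rule summable_comparison_test'[OF sM, of 0]) (use le in auto)
  then show "weighted_shift w a \<in> ell p" by (simp add: ell_def)
  have "(\<Sum>n. norm (weighted_shift w a n) powr p) \<le> (\<Sum>n. M powr p * norm (a (Suc n)) powr p)"
    using le sb sM by (rule suminf_le)
  also have "\<dots> = M powr p * (\<Sum>n. norm (a (Suc n)) powr p)"
    using sS by (rule suminf_mult)
  also have "\<dots> \<le> M powr p * (\<Sum>n. norm (a n) powr p)"
    using suminf_split_head[OF sa] by (intro mult_left_mono) auto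
  finally have "ell_norm p (weighted_shift w a)
      \<le> (M powr p * (\<Sum>n. norm (a n) powr p)) powr (1 / p)"
    unfolding ell_norm_def using p by (intro powr_mono2 suminf_nonneg sb) auto
  also have "\<dots> = M * ell_norm p a"
    using M p suminf_nonneg[OF sa] by (simp add: powr_mult powr_powr ell_norm_def)
  finally show "ell_norm p (weighted_shift w a) \<le> M * ell_norm p a" .
qed

lemma weighted_shift_c_null:
  assumes w: "\<And>n. n \<ge> 1 \<Longrightarrow> 0 < w n \<and> w n \<le> M" and a: "a \<in> c_null"
  shows "weighted_shift w a \<in> c_null"
    and "sup_norm (weighted_shift w a) \<le> M * sup_norm a"
proof -
  have M: "0 < M" using w[of 1] by auto
  have lim: "a \<longlonglongrightarrow> 0" using a by (simp add: c_null_def)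
  then have "Bseq a" by (metis convergentI convergent_imp_Bseq)
  then obtain K where "\<And>n. norm (a n) \<le> K" by (auto simp: Bseq_def)
  then have bdd: "bdd_above (range (\<lambda>n. norm (a n)))" by (rule bdd_aboveI2)
  have le: "norm (weighted_shift w a n) \<le> M * norm (a (Suc n))" for n
    using w[of "Suc n"] by (simp add: weighted_shift_def norm_mult mult_right_mono)
  have "(\<lambda>n. M * norm (a (Suc n))) \<longlonglongrightarrow> M * 0"
    by (rule tendsto_mult[OF tendsto_const tendsto_norm_zero[OF LIMSEQ_Suc[OF lim]]])
  then have "(\<lambda>n. M * norm (a (Suc n))) \<longlonglongrightarrow> 0" by simp
  then have "weighted_shift w a \<longlonglongrightarrow> 0"
    by (rule Lim_null_comparison[OF always_eventually, rotated]) (simp_all add: le)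
  then show "weighted_shift w a \<in> c_null" by (simp add: c_null_def)
  have "norm (weighted_shift w a n) \<le> M * sup_norm a" for n
  proof -
    have "norm (a (Suc n)) \<le> sup_norm a"
      unfolding sup_norm_def by (rule cSUP_upper[OF UNIV_I bdd])
    then have "M * norm (a (Suc n)) \<le> M * sup_norm a" using M by simp
    with le[of n] show ?thesis by linarith
  qed
  then show "sup_norm (weighted_shift w a) \<le> M * sup_norm a"
    unfolding sup_norm_def[of "weighted_shift w a"] by - (rule cSUP_least, auto)
qed

end

theory Submission
  imports Defs
begin

text \<open>The spaces \<open>\<ell>\<^sup>p\<close> and \<open>c\<^sub>0\<close> share three features that determine the constant: a coordinate
  is bounded by the norm, a sequence supported at one index has the modulus of its entry as norm,
  and a sequence that starts with \<open>0\<close> and is then dominated entrywise by \<open>C\<close> times a sequence \<open>y\<close>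
  of the space lies in the space, with norm at most \<open>C \<parallel>y\<parallel>\<close>.

  Every preimage of \<open>w\<^sub>n e\<^bsub>n-1\<^esub>\<close> under the weighted shift has \<open>n\<close>-th coordinate \<open>1\<close>, hence norm at
  least \<open>1\<close>; so this vector of norm \<open>w\<^sub>n\<close> lies outside the image of the open unit ball, and
  \<open>\<epsilon> \<le> w\<^sub>n\<close>. Conversely let \<open>m\<close> be the infimum of the weights and let \<open>y\<close> have norm less than \<open>m\<close>.
  Then \<open>m > 0\<close>, and the preimage \<open>(0, y\<^sub>0/w\<^sub>1, y\<^sub>1/w\<^sub>2, \<dots>)\<close> has norm at most \<open>\<parallel>y\<parallel>/m < 1\<close>; so all
  vectors outside the image have norm at least \<open>m\<close>. This is \<open>epsilon_weighted_shift\<close>; the two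
  \<open>forward_shift\<close> lemmas supply its main hypothesis, the domination property.\<close>

lemma epsilon_weighted_shift:
  fixes w :: "nat \<Rightarrow> real" and X :: "(nat \<Rightarrow> complex) set"
  assumes w_pos: "\<And>n. n \<ge> 1 \<Longrightarrow> 0 < w n"
    and coord: "\<And>a n. a \<in> X \<Longrightarrow> norm (a n) \<le> N a"
    and single_mem: "\<And>c n. (\<lambda>k. if k = n then c else 0) \<in> X"
    and single_norm: "\<And>c n. N (\<lambda>k. if k = n then c else 0) = norm c"
    and shift_mem: "\<And>C a y. \<lbrakk>y \<in> X; 0 < C; a 0 = 0; \<And>n. norm (a (Suc n)) \<le> C * norm (y n)\<rbrakk>
        \<Longrightarrow> a \<in> X"
    and shift_norm: "\<And>C a y. \<lbrakk>y \<in> X; 0 < C; a 0 = 0; \<And>n. norm (a (Suc n)) \<le> C * norm (y n)\<rbrakk>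
        \<Longrightarrow> N a \<le> C * N y"
  shows "epsilon X N (weighted_shift w) = (INF n\<in>{1..}. w n)"
proof -
  define m where "m = (INF n\<in>{1..}. w n)"
  define Out where "Out = X - weighted_shift w ` {x \<in> X. N x < 1}"
  have N_nonneg: "0 \<le> N a" if "a \<in> X" for a
    using coord[OF that, of 0] by (rule order_trans[OF norm_ge_zero])
  have w_bdd: "bdd_below (w ` {1..})"
    using w_pos by (intro bdd_belowI[of _ 0]) (auto intro: less_imp_le)
  have m_le: "m \<le> w n" if "n \<ge> 1" for n
    unfolding m_def using w_bdd that by (intro cINF_lower) auto
  have spike: "(\<lambda>k. if k = n - 1 then of_real (w n) else 0) \<in> Out" if n: "n \<ge> 1" for n
  proof -
    have "\<not> N a < 1" if a: "a \<in> X"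
      and eq: "weighted_shift w a = (\<lambda>k. if k = n - 1 then of_real (w n) else 0)" for a
    proof -
      have "of_real (w n) * a n = of_real (w n)"
        using fun_cong[OF eq, of "n - 1"] n by (simp add: weighted_shift_def)
      then have "a n = 1" using w_pos[OF n] by simp
      then show ?thesis using coord[OF a, of n] by simp
    qed
    then show ?thesis
      using single_mem[of "n - 1" "of_real (w n)"] by (auto simp: Out_def)
  qed
  have m_lower: "m \<le> N y" if y: "y \<in> Out" for y
  proof (rule ccontr)
    assume "\<not> m \<le> N y"
    then have less: "N y < m" by simp
    have yX: "y \<in> X" using y by (simp add: Out_def)
    have m0: "0 < m" using N_nonneg[OF yX] less by linarith
    \<comment> \<open>The preimage of \<open>y\<close> of least norm: the shift forgets the entry at \<open>0\<close> and determines all others.\<close>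
    define a where "a = (\<lambda>n. case n of 0 \<Rightarrow> 0 | Suc k \<Rightarrow> y k / of_real (w (Suc k)))"
    have a0: "a 0 = 0" by (simp add: a_def)
    have aS: "norm (a (Suc n)) \<le> (1 / m) * norm (y n)" for n
    proof -
      have "norm (y n) / w (Suc n) \<le> norm (y n) / m"
        using m_le[of "Suc n"] m0 by (intro divide_left_mono) auto
      then show ?thesis using w_pos[of "Suc n"] by (simp add: a_def norm_divide)
    qed
    have "a \<in> X" using shift_mem[OF yX _ a0 aS] m0 by simp
    moreover have "N a < 1"
    proof -
      have "N a \<le> (1 / m) * N y" using shift_norm[OF yX _ a0 aS] m0 by simp
      also have "\<dots> < 1" using m0 less by simp
      finally show ?thesis .
    qed
    moreover have "weighted_shift w a = y"
    proof
      fix n show "weighted_shift w a n = y n"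
        using w_pos[of "Suc n"] by (simp add: weighted_shift_def a_def)
    qed
    ultimately show False using y by (auto simp: Out_def)
  qed
  have "Inf (N ` Out) = m"
  proof (rule antisym)
    have bdd: "bdd_below (N ` Out)" using m_lower by (intro bdd_belowI[of _ m]) auto
    have "Inf (N ` Out) \<le> w n" if n: "n \<ge> 1" for n
    proof -
      have "Inf (N ` Out) \<le> N (\<lambda>k. if k = n - 1 then of_real (w n) else 0)"
        using bdd spike[OF n] by (intro cINF_lower)
      also have "\<dots> = w n" using w_pos[OF n] by (simp add: single_norm)
      finally show ?thesis .
    qed
    then show "Inf (N ` Out) \<le> m" unfolding m_def by (intro cINF_greatest) auto
    show "m \<le> Inf (N ` Out)" using spike[of 1] m_lower by (intro cINF_greatest) auto
  qed
  then show ?thesis by (simp add: epsilon_def Out_def m_def)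
qed

lemma norm_coord_le_ell_norm:
  assumes p: "0 < p" and a: "a \<in> ell p"
  shows "norm (a n) \<le> ell_norm p a"
proof -
  have "norm (a n) powr p = (\<Sum>k\<in>{n}. norm (a k) powr p)" by simp
  also have "\<dots> \<le> (\<Sum>k. norm (a k) powr p)"
    using a by (intro sum_le_suminf) (auto simp: ell_def)
  finally have "(norm (a n) powr p) powr (1 / p) \<le> ell_norm p a"
    unfolding ell_norm_def using p by (intro powr_mono2) auto
  then show ?thesis using p by (simp add: powr_powr)
qed

lemma single_ell:
  assumes p: "0 < p"
  shows "(\<lambda>k. if k = n then c else 0) \<in> ell p"
    and "ell_norm p (\<lambda>k. if k = n then c else 0) = norm c"
proof -
  have "(\<lambda>k. if k = n then norm c powr p else 0) sums (norm c powr p)"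
    using sums_single[of n "\<lambda>_. norm c powr p"] by simp
  moreover have "(\<lambda>k. norm (if k = n then c else 0) powr p)
      = (\<lambda>k. if k = n then norm c powr p else 0)"
    using p by auto
  ultimately have "(\<lambda>k. norm (if k = n then c else 0) powr p) sums (norm c powr p)" by simp
  then show "(\<lambda>k. if k = n then c else 0) \<in> ell p"
    and "ell_norm p (\<lambda>k. if k = n then c else 0) = norm c"
    using p by (auto simp: ell_def ell_norm_def powr_powr sums_iff)
qed

lemma forward_shift_ell:
  assumes p: "0 < p" and y: "y \<in> ell p" and C: "0 < C" and a0: "a 0 = 0"
    and le: "\<And>n. norm (a (Suc n)) \<le> C * norm (y n)"
  shows "a \<in> ell p" and "ell_norm p a \<le> C * ell_norm p y"
proof -
  have sy: "summable (\<lambda>n. norm (y n) powr p)" using y by (simp add: ell_def)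
  then have sCy: "summable (\<lambda>n. C powr p * norm (y n) powr p)" by (rule summable_mult)
  have le_p: "norm (a (Suc n)) powr p \<le> C powr p * norm (y n) powr p" for n
    using powr_mono2[OF _ norm_ge_zero le[of n], of p] p C by (simp add: powr_mult)
  have sS: "summable (\<lambda>n. norm (a (Suc n)) powr p)"
    by (rule summable_comparison_test'[OF sCy, of 0]) (use le_p in auto)
  then have sa: "summable (\<lambda>n. norm (a n) powr p)" by (subst (asm) summable_Suc_iff)
  then show "a \<in> ell p" by (simp add: ell_def)
  have "(\<Sum>n. norm (a n) powr p) = (\<Sum>n. norm (a (Suc n)) powr p)"
    using suminf_split_head[OF sa] a0 p by simp
  also have "\<dots> \<le> (\<Sum>n. C powr p * norm (y n) powr p)" using le_p sS sCy by (rule suminf_le)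
  also have "\<dots> = C powr p * (\<Sum>n. norm (y n) powr p)" using sy by (rule suminf_mult)
  finally have "ell_norm p a \<le> (C powr p * (\<Sum>n. norm (y n) powr p)) powr (1 / p)"
    unfolding ell_norm_def using p by (intro powr_mono2 suminf_nonneg sa) auto
  also have "\<dots> = C * ell_norm p y"
    using C p suminf_nonneg[OF sy] by (simp add: powr_mult powr_powr ell_norm_def)
  finally show "ell_norm p a \<le> C * ell_norm p y" .
qed

lemma norm_coord_le_sup_norm:
  assumes "a \<in> c_null"
  shows "norm (a n) \<le> sup_norm a"
proof -
  have "Bseq a" using assms by (auto simp: c_null_def intro: convergent_imp_Bseq convergentI)
  then obtain K where "\<And>n. norm (a n) \<le> K" by (auto simp: Bseq_def)
  then have "bdd_above (range (\<lambda>n. norm (a n)))" by (rule bdd_aboveI2)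
  then show ?thesis unfolding sup_norm_def by (rule cSUP_upper[OF UNIV_I])
qed

lemma single_c_null:
  shows "(\<lambda>k. if k = n then c else 0) \<in> c_null"
    and "sup_norm (\<lambda>k. if k = n then c else 0) = norm c"
proof -
  have "(\<lambda>k. if k = n then c else 0) \<longlonglongrightarrow> 0"
    by (rule tendsto_eventually, rule eventually_sequentiallyI[of "Suc n"]) auto
  then show mem: "(\<lambda>k. if k = n then c else 0) \<in> c_null" by (simp add: c_null_def)
  show "sup_norm (\<lambda>k. if k = n then c else 0) = norm c"
  proof (rule antisym)
    show "sup_norm (\<lambda>k. if k = n then c else 0) \<le> norm c"
      unfolding sup_norm_def by (rule cSUP_least) auto
    show "norm c \<le> sup_norm (\<lambda>k. if k = n then c else 0)"
      using norm_coord_le_sup_norm[OF mem, of n] by simp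
  qed
qed

lemma forward_shift_c_null:
  assumes y: "y \<in> c_null" and C: "0 < C" and a0: "a 0 = 0"
    and le: "\<And>n. norm (a (Suc n)) \<le> C * norm (y n)"
  shows "a \<in> c_null" and "sup_norm a \<le> C * sup_norm y"
proof -
  have "(\<lambda>n. C * norm (y n)) \<longlonglongrightarrow> 0"
    using y by (auto simp: c_null_def intro: tendsto_mult_right_zero tendsto_norm_zero)
  then have "(\<lambda>n. a (Suc n)) \<longlonglongrightarrow> 0"
    by (rule Lim_null_comparison[OF always_eventually, rotated]) (simp add: le)
  then show "a \<in> c_null" unfolding c_null_def by (simp add: filterlim_sequentially_Suc)
  have bound: "C * norm (y n) \<le> C * sup_norm y" for n
    using norm_coord_le_sup_norm[OF y, of n] C by simp
  have "norm (a n) \<le> C * sup_norm y" for n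
  proof (cases n)
    case 0
    have "0 \<le> C * norm (y 0)" using C by simp
    then show ?thesis using bound[of 0] a0 0 by simp
  next
    case (Suc k)
    then show ?thesis using le[of k] bound[of k] by simp
  qed
  then show "sup_norm a \<le> C * sup_norm y"
    unfolding sup_norm_def[of a] by (intro cSUP_least) auto
qed

theorem proposition3p4:
  fixes w :: "nat \<Rightarrow> real"
  assumes "\<And>n. n \<ge> 1 \<Longrightarrow> 0 < w n"
    and "bdd_above (w ` {1..})"
  shows "(\<forall>p::real. 1 \<le> p \<longrightarrow>
            epsilon (ell p) (ell_norm p) (weighted_shift w) = (INF n\<in>{1..}. w n)) \<and>
         epsilon c_null sup_norm (weighted_shift w) = (INF n\<in>{1..}. w n)"
proof (intro conjI allI impI)
  fix p :: real
  assume "1 \<le> p"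
  then have p: "0 < p" by simp
  show "epsilon (ell p) (ell_norm p) (weighted_shift w) = (INF n\<in>{1..}. w n)"
    by (rule epsilon_weighted_shift[OF assms(1) norm_coord_le_ell_norm[OF p]
          single_ell[OF p] forward_shift_ell[OF p]])
next
  show "epsilon c_null sup_norm (weighted_shift w) = (INF n\<in>{1..}. w n)"
    by (rule epsilon_weighted_shift[OF assms(1) norm_coord_le_sup_norm
          single_c_null forward_shift_c_null])
qed

end
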